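(* Let $m_1$ and $m_2$ be mass functions on frames $\Theta_1$ and $\Theta_2$ respectively, with $k_{1,2}<1$, whose evidence combination satisfies the open-world criterion, i.e. $\Upsilon_{1,2}\neq\emptyset$, and let $m_{1,2}$ be their combination via Dempster's combination rule, with plausibility function $Pl_{1,2}$. Let $U_i$ be the union of all focal elements of $m_i$ ($i=1,2$) and define the consensus set $U_{\mathrm{cons}}=(U_1\cup U_2)\setminus\Upsilon_{1,2}$. Then $Pl_{1,2}(U_{\mathrm{cons}})=1$, and this remains invariant under further combination with any new evidence: for every mass function $m_3$ (on any frame) such that the Dempster combination of $m_{1,2}$ and $m_3$ is defined, the plausibility function of that combination takes the value $1$ at $U_{\mathrm{cons}}$.
   Context: A frame $\Theta$ is a finite set of mutually exclusive and exhaustive elements. A mass function on $\Theta$ is a map $m:2^\Theta\to[0,1]$ with $m(\emptyset)=0$ and $\sum_{A\subseteq\Theta}m(A)=1$. A focal element of $m$ is a subset $A\subseteq\Theta$ with $m(A)>0$. The plausibility function is $Pl(A)=\sum_{B\cap A\neq\emptyset}m(B)$. Mass functions on different frames are regarded as set functions on subsets of the union of the frames (zero on sets not contained in the respective frame). Dempster's combination rule: for mass functions $m_1,m_2$ put $k_{1,2}=\sum_{A\cap B=\emptyset}m_1(A)m_2(B)$. The combination is defined when $k_{1,2}<1$, and then $m_{1,2}(\emptyset)=0$ and $m_{1,2}(x)=\frac{1}{1-k_{1,2}}\sum_{A\cap B=x}m_1(A)m_2(B)$ for $x\neq\emptyset$. Open-world criterion: let $F_1,F_2$ be the sets of focal elements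 of $m_1,m_2$. The set of essential conflict elements $\Upsilon_{1,2}\subseteq\Theta_1\cup\Theta_2$ is the set of all $\omega$ for which there are $i\neq j$ in $\{1,2\}$ and $A\in F_i$ with $\omega\in A$ such that $A\cap B=\emptyset$ for all $B\in F_j$. The evidence combination of $m_1$ and $m_2$ satisfies the open-world criterion if $\Upsilon_{1,2}\neq\emptyset$. *)

theory Defs
  imports Complex_Main
begin

text \<open>
  All frames are finite subsets of one ambient type; a mass function on a frame is a total set
  function that vanishes off the power set of its frame, so that mass functions on different
  frames can be compared and combined.
\<close>

definition mass_function :: "'a set \<Rightarrow> ('a set \<Rightarrow> real) \<Rightarrow> bool" where
  "mass_function \<Theta> m \<longleftrightarrow>
     finite \<Theta> \<and>
     (\<forall>A. A \<subseteq> \<Theta> \<longrightarrow> 0 \<le> m A \<and> m A \<le> 1) \<and>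
     (\<forall>A. \<not> A \<subseteq> \<Theta> \<longrightarrow> m A = 0) \<and>
     m {} = 0 \<and>
     (\<Sum>A\<in>Pow \<Theta>. m A) = 1"

definition focal_elements :: "'a set \<Rightarrow> ('a set \<Rightarrow> real) \<Rightarrow> 'a set set" where
  "focal_elements \<Theta> m = {A. A \<subseteq> \<Theta> \<and> m A > 0}"

definition plausibility :: "'a set \<Rightarrow> ('a set \<Rightarrow> real) \<Rightarrow> 'a set \<Rightarrow> real" where
  "plausibility \<Theta> m A = (\<Sum>B | B \<subseteq> \<Theta> \<and> B \<inter> A \<noteq> {}. m B)"

definition conflict ::
  "'a set \<Rightarrow> ('a set \<Rightarrow> real) \<Rightarrow> 'a set \<Rightarrow> ('a set \<Rightarrow> real) \<Rightarrow> real" where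
  "conflict \<Theta>\<^sub>1 m\<^sub>1 \<Theta>\<^sub>2 m\<^sub>2 =
     (\<Sum>(A, B) | A \<subseteq> \<Theta>\<^sub>1 \<and> B \<subseteq> \<Theta>\<^sub>2 \<and> A \<inter> B = {}. m\<^sub>1 A * m\<^sub>2 B)"

text \<open>
  The combination is regarded as a set function on the frame \<open>\<Theta>\<^sub>1 \<union> \<Theta>\<^sub>2\<close>. It is meaningful
  only if the conflict is less than 1; this is a hypothesis wherever the combination is used.
\<close>

definition dempster ::
  "'a set \<Rightarrow> ('a set \<Rightarrow> real) \<Rightarrow> 'a set \<Rightarrow> ('a set \<Rightarrow> real) \<Rightarrow> 'a set \<Rightarrow> real" where
  "dempster \<Theta>\<^sub>1 m\<^sub>1 \<Theta>\<^sub>2 m\<^sub>2 x =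
     (if x = {} then 0
      else 1 / (1 - conflict \<Theta>\<^sub>1 m\<^sub>1 \<Theta>\<^sub>2 m\<^sub>2) *
             (\<Sum>(A, B) | A \<subseteq> \<Theta>\<^sub>1 \<and> B \<subseteq> \<Theta>\<^sub>2 \<and> A \<inter> B = x. m\<^sub>1 A * m\<^sub>2 B))"

definition essential_conflict ::
  "'a set \<Rightarrow> ('a set \<Rightarrow> real) \<Rightarrow> 'a set \<Rightarrow> ('a set \<Rightarrow> real) \<Rightarrow> 'a set" where
  "essential_conflict \<Theta>\<^sub>1 m\<^sub>1 \<Theta>\<^sub>2 m\<^sub>2 =
     {\<omega> \<in> \<Theta>\<^sub>1 \<union> \<Theta>\<^sub>2.
        (\<exists>A \<in> focal_elements \<Theta>\<^sub>1 m\<^sub>1. \<omega> \<in> A \<and> (\<forall>B \<in> focal_elements \<Theta>\<^sub>2 m\<^sub>2. A \<inter> B = {})) \<or>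
        (\<exists>A \<in> focal_elements \<Theta>\<^sub>2 m\<^sub>2. \<omega> \<in> A \<and> (\<forall>B \<in> focal_elements \<Theta>\<^sub>1 m\<^sub>1. A \<inter> B = {}))}"

definition open_world ::
  "'a set \<Rightarrow> ('a set \<Rightarrow> real) \<Rightarrow> 'a set \<Rightarrow> ('a set \<Rightarrow> real) \<Rightarrow> bool" where
  "open_world \<Theta>\<^sub>1 m\<^sub>1 \<Theta>\<^sub>2 m\<^sub>2 \<longleftrightarrow> essential_conflict \<Theta>\<^sub>1 m\<^sub>1 \<Theta>\<^sub>2 m\<^sub>2 \<noteq> {}"

definition consensus_set ::
  "'a set \<Rightarrow> ('a set \<Rightarrow> real) \<Rightarrow> 'a set \<Rightarrow> ('a set \<Rightarrow> real) \<Rightarrow> 'a set" where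
  "consensus_set \<Theta>\<^sub>1 m\<^sub>1 \<Theta>\<^sub>2 m\<^sub>2 =
     (\<Union>(focal_elements \<Theta>\<^sub>1 m\<^sub>1) \<union> \<Union>(focal_elements \<Theta>\<^sub>2 m\<^sub>2)) -
     essential_conflict \<Theta>\<^sub>1 m\<^sub>1 \<Theta>\<^sub>2 m\<^sub>2"

end

theory Submission
  imports Defs
begin

text \<open>
  An element common to focal elements \<open>A\<close> of \<open>m\<^sub>1\<close> and \<open>B\<close> of \<open>m\<^sub>2\<close> cannot be an essential conflict
  element, since every focal element containing it meets \<open>A\<close> or \<open>B\<close>. Hence all focal elements of
  the combination lie inside the consensus set. Combining further only intersects focal elements,
  so this containment persists; and a mass function whose focal elements all lie inside \<open>U\<close> has
  plausibility 1 at \<open>U\<close>.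
\<close>

lemma mass_function_nonneg:
  assumes "mass_function \<Theta> m"
  shows "0 \<le> m A"
  using assms unfolding mass_function_def by (cases "A \<subseteq> \<Theta>") auto

text \<open>The subsets of the frame left out of the plausibility sum are disjoint from
  \<open>U\<close> and carry no mass: a nonempty one with positive mass would be focal, hence inside
  \<open>U\<close>, hence not disjoint from it.\<close>

lemma plausibility_eq_1:
  assumes m: "mass_function \<Theta> m"
    and focal: "\<And>A. A \<in> focal_elements \<Theta> m \<Longrightarrow> A \<subseteq> U"
  shows "plausibility \<Theta> m U = 1"
proof -
  have "(\<Sum>B | B \<subseteq> \<Theta> \<and> B \<inter> U \<noteq> {}. m B) = (\<Sum>B\<in>Pow \<Theta>. m B)"
  proof (rule sum.mono_neutral_left)
    show "finite (Pow \<Theta>)"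
      using m by (simp add: mass_function_def)
    show "\<forall>B\<in>Pow \<Theta> - {B. B \<subseteq> \<Theta> \<and> B \<inter> U \<noteq> {}}. m B = 0"
    proof
      fix B assume B: "B \<in> Pow \<Theta> - {B. B \<subseteq> \<Theta> \<and> B \<inter> U \<noteq> {}}"
      show "m B = 0"
      proof (rule ccontr)
        assume "m B \<noteq> 0"
        moreover from this have "B \<noteq> {}"
          using m by (auto simp: mass_function_def)
        ultimately have "B \<in> focal_elements \<Theta> m"
          using B mass_function_nonneg[OF m, of B] by (auto simp: focal_elements_def)
        with focal B \<open>B \<noteq> {}\<close> show False by auto
      qed
    qed
  qed auto
  then show ?thesis
    using m by (simp add: plausibility_def mass_function_def)
qed

text \<open>A nonzero sum has a nonzero summand, and nonnegativity turns nonzero factors into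
  positive ones. The frame \<open>\<Theta>\<close> is left free because only the positive value at
  \<open>x\<close> matters.\<close>

lemma focal_elements_dempster:
  assumes m1: "mass_function \<Theta>\<^sub>1 m\<^sub>1" and m2: "mass_function \<Theta>\<^sub>2 m\<^sub>2"
    and x: "x \<in> focal_elements \<Theta> (dempster \<Theta>\<^sub>1 m\<^sub>1 \<Theta>\<^sub>2 m\<^sub>2)"
  obtains A B where "A \<in> focal_elements \<Theta>\<^sub>1 m\<^sub>1" "B \<in> focal_elements \<Theta>\<^sub>2 m\<^sub>2" "x = A \<inter> B"
proof -
  have "(\<Sum>(A, B) | A \<subseteq> \<Theta>\<^sub>1 \<and> B \<subseteq> \<Theta>\<^sub>2 \<and> A \<inter> B = x. m\<^sub>1 A * m\<^sub>2 B) \<noteq> 0"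
    using x by (auto simp: focal_elements_def dempster_def split: if_splits)
  then obtain p where
    "p \<in> {(A, B). A \<subseteq> \<Theta>\<^sub>1 \<and> B \<subseteq> \<Theta>\<^sub>2 \<and> A \<inter> B = x}" "(case p of (A, B) \<Rightarrow> m\<^sub>1 A * m\<^sub>2 B) \<noteq> 0"
    by (rule sum.not_neutral_contains_not_neutral)
  then obtain A B where "A \<subseteq> \<Theta>\<^sub>1" "B \<subseteq> \<Theta>\<^sub>2" "A \<inter> B = x" "m\<^sub>1 A \<noteq> 0" "m\<^sub>2 B \<noteq> 0"
    by auto
  with mass_function_nonneg[OF m1, of A] mass_function_nonneg[OF m2, of B] show ?thesis
    by (intro that[of A B]) (auto simp: focal_elements_def)
qed

text \<open>The products have total 1 over all pairs of subsets. Disjoint pairs account for the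
  conflict, so the intersecting pairs, collected in \<open>Q\<close>, account for the rest, which is
  exactly the normalising denominator.\<close>

lemma sum_dempster:
  assumes m1: "mass_function \<Theta>\<^sub>1 m\<^sub>1" and m2: "mass_function \<Theta>\<^sub>2 m\<^sub>2"
    and k: "conflict \<Theta>\<^sub>1 m\<^sub>1 \<Theta>\<^sub>2 m\<^sub>2 < 1"
  shows "(\<Sum>x\<in>Pow (\<Theta>\<^sub>1 \<union> \<Theta>\<^sub>2). dempster \<Theta>\<^sub>1 m\<^sub>1 \<Theta>\<^sub>2 m\<^sub>2 x) = 1"
proof -
  define h where "h = (\<lambda>(A, B). m\<^sub>1 A * m\<^sub>2 B)"
  define P where "P = Pow \<Theta>\<^sub>1 \<times> Pow \<Theta>\<^sub>2"
  define Q where "Q = {p \<in> P. fst p \<inter> snd p \<noteq> {}}"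
  define T where "T = Pow (\<Theta>\<^sub>1 \<union> \<Theta>\<^sub>2) - {{}}"
  let ?k = "conflict \<Theta>\<^sub>1 m\<^sub>1 \<Theta>\<^sub>2 m\<^sub>2"
  have fin: "finite \<Theta>\<^sub>1" "finite \<Theta>\<^sub>2"
    and one: "(\<Sum>A\<in>Pow \<Theta>\<^sub>1. m\<^sub>1 A) = 1" "(\<Sum>B\<in>Pow \<Theta>\<^sub>2. m\<^sub>2 B) = 1"
    using m1 m2 by (auto simp: mass_function_def)
  have finP: "finite P" and finT: "finite T"
    using fin by (auto simp: P_def T_def)
  have "sum h P = (\<Sum>A\<in>Pow \<Theta>\<^sub>1. m\<^sub>1 A) * (\<Sum>B\<in>Pow \<Theta>\<^sub>2. m\<^sub>2 B)"
    by (simp add: h_def P_def sum_product sum.cartesian_product)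
  then have "sum h P = 1"
    by (simp add: one)
  moreover have "sum h (P - Q) = ?k"
    unfolding conflict_def h_def by (rule sum.cong) (auto simp: P_def Q_def)
  moreover have "sum h P = sum h (P - Q) + sum h Q"
    using finP by (intro sum.subset_diff) (auto simp: Q_def)
  ultimately have sumQ: "sum h Q = 1 - ?k"
    by simp
  have "(\<Sum>x\<in>Pow (\<Theta>\<^sub>1 \<union> \<Theta>\<^sub>2). dempster \<Theta>\<^sub>1 m\<^sub>1 \<Theta>\<^sub>2 m\<^sub>2 x)
      = (\<Sum>x\<in>T. dempster \<Theta>\<^sub>1 m\<^sub>1 \<Theta>\<^sub>2 m\<^sub>2 x)"
    using fin by (intro sum.mono_neutral_right) (auto simp: T_def dempster_def)
  also have "\<dots> = (\<Sum>x\<in>T. 1 / (1 - ?k) * sum h {p \<in> Q. fst p \<inter> snd p = x})"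
  proof (rule sum.cong[OF refl])
    fix x assume "x \<in> T"
    then have "x \<noteq> {}" by (simp add: T_def)
    \<comment> \<open>For nonempty \<open>x\<close> the condition defining \<open>Q\<close> holds
      automatically, so restricting to \<open>Q\<close> loses no pair.\<close>
    then have "{p \<in> Q. fst p \<inter> snd p = x} = {(A, B). A \<subseteq> \<Theta>\<^sub>1 \<and> B \<subseteq> \<Theta>\<^sub>2 \<and> A \<inter> B = x}"
      by (auto simp: Q_def P_def)
    with \<open>x \<noteq> {}\<close> show "dempster \<Theta>\<^sub>1 m\<^sub>1 \<Theta>\<^sub>2 m\<^sub>2 x
        = 1 / (1 - ?k) * sum h {p \<in> Q. fst p \<inter> snd p = x}"
      by (simp add: dempster_def h_def)
  qed
  also have "\<dots> = 1 / (1 - ?k) * (\<Sum>x\<in>T. sum h {p \<in> Q. fst p \<inter> snd p = x})"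
    by (simp add: sum_distrib_left)
  \<comment> \<open>The fibres of the intersection map partition \<open>Q\<close>, since every pair
    in \<open>Q\<close> has its intersection in \<open>T\<close>.\<close>
  also have "(\<Sum>x\<in>T. sum h {p \<in> Q. fst p \<inter> snd p = x}) = sum h Q"
    using finP finT by (intro sum.group) (auto simp: Q_def P_def T_def)
  finally show ?thesis
    using k by (simp add: sumQ)
qed

text \<open>This allows a combination to serve as an input of a further combination.\<close>

lemma mass_function_dempster:
  assumes m1: "mass_function \<Theta>\<^sub>1 m\<^sub>1" and m2: "mass_function \<Theta>\<^sub>2 m\<^sub>2"
    and k: "conflict \<Theta>\<^sub>1 m\<^sub>1 \<Theta>\<^sub>2 m\<^sub>2 < 1"
  shows "mass_function (\<Theta>\<^sub>1 \<union> \<Theta>\<^sub>2) (dempster \<Theta>\<^sub>1 m\<^sub>1 \<Theta>\<^sub>2 m\<^sub>2)"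
proof -
  let ?d = "dempster \<Theta>\<^sub>1 m\<^sub>1 \<Theta>\<^sub>2 m\<^sub>2"
  have fin: "finite (\<Theta>\<^sub>1 \<union> \<Theta>\<^sub>2)"
    using m1 m2 by (simp add: mass_function_def)
  have nonneg: "0 \<le> ?d x" for x
    using k mass_function_nonneg[OF m1] mass_function_nonneg[OF m2]
    by (auto simp: dempster_def intro!: divide_nonneg_nonneg sum_nonneg mult_nonneg_nonneg)
  have "?d x \<le> 1" if "x \<subseteq> \<Theta>\<^sub>1 \<union> \<Theta>\<^sub>2" for x
    \<comment> \<open>The bound 1 is rewritten as the total mass, which dominates each of its
      nonnegative summands.\<close>
    unfolding sum_dempster[OF m1 m2 k, symmetric]
    using that fin nonneg by (intro member_le_sum) auto
  moreover have "?d x = 0" if "\<not> x \<subseteq> \<Theta>\<^sub>1 \<union> \<Theta>\<^sub>2" for x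
  proof -
    have "{(A, B). A \<subseteq> \<Theta>\<^sub>1 \<and> B \<subseteq> \<Theta>\<^sub>2 \<and> A \<inter> B = x} = {}"
      using that by auto
    then show ?thesis
      \<comment> \<open>The empty sum makes both branches of the conditional 0, so
        \<open>if_cancel\<close> removes the need to decide whether \<open>x\<close> is
        empty.\<close>
      by (simp only: dempster_def sum.empty mult_zero_right if_cancel)
  qed
  moreover have "?d {} = 0"
    by (simp add: dempster_def)
  ultimately show ?thesis
    using fin nonneg sum_dempster[OF m1 m2 k] by (simp add: mass_function_def)
qed

lemma focal_elements_dempster_subset_consensus_set:
  assumes "mass_function \<Theta>\<^sub>1 m\<^sub>1" "mass_function \<Theta>\<^sub>2 m\<^sub>2"
    and "x \<in> focal_elements \<Theta> (dempster \<Theta>\<^sub>1 m\<^sub>1 \<Theta>\<^sub>2 m\<^sub>2)"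
  shows "x \<subseteq> consensus_set \<Theta>\<^sub>1 m\<^sub>1 \<Theta>\<^sub>2 m\<^sub>2"
proof -
  obtain A B where "A \<in> focal_elements \<Theta>\<^sub>1 m\<^sub>1" "B \<in> focal_elements \<Theta>\<^sub>2 m\<^sub>2" "x = A \<inter> B"
    using assms by (rule focal_elements_dempster)
  then show ?thesis
    unfolding consensus_set_def essential_conflict_def by blast
qed

theorem theorem2:
  fixes \<Theta>\<^sub>1 \<Theta>\<^sub>2 :: "'a set" and m\<^sub>1 m\<^sub>2 :: "'a set \<Rightarrow> real"
  assumes "mass_function \<Theta>\<^sub>1 m\<^sub>1"
    and "mass_function \<Theta>\<^sub>2 m\<^sub>2"
    and "conflict \<Theta>\<^sub>1 m\<^sub>1 \<Theta>\<^sub>2 m\<^sub>2 < 1"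
    and "open_world \<Theta>\<^sub>1 m\<^sub>1 \<Theta>\<^sub>2 m\<^sub>2"
  shows "let \<Theta>\<^sub>1\<^sub>2 = \<Theta>\<^sub>1 \<union> \<Theta>\<^sub>2;
             m\<^sub>1\<^sub>2 = dempster \<Theta>\<^sub>1 m\<^sub>1 \<Theta>\<^sub>2 m\<^sub>2;
             U = consensus_set \<Theta>\<^sub>1 m\<^sub>1 \<Theta>\<^sub>2 m\<^sub>2
         in plausibility \<Theta>\<^sub>1\<^sub>2 m\<^sub>1\<^sub>2 U = 1 \<and>
            (\<forall>\<Theta>\<^sub>3 m\<^sub>3. mass_function \<Theta>\<^sub>3 m\<^sub>3 \<and> conflict \<Theta>\<^sub>1\<^sub>2 m\<^sub>1\<^sub>2 \<Theta>\<^sub>3 m\<^sub>3 < 1 \<longrightarrow>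
               plausibility (\<Theta>\<^sub>1\<^sub>2 \<union> \<Theta>\<^sub>3) (dempster \<Theta>\<^sub>1\<^sub>2 m\<^sub>1\<^sub>2 \<Theta>\<^sub>3 m\<^sub>3) U = 1)"
proof -
  let ?m = "dempster \<Theta>\<^sub>1 m\<^sub>1 \<Theta>\<^sub>2 m\<^sub>2"
  let ?U = "consensus_set \<Theta>\<^sub>1 m\<^sub>1 \<Theta>\<^sub>2 m\<^sub>2"
  have m: "mass_function (\<Theta>\<^sub>1 \<union> \<Theta>\<^sub>2) ?m"
    using assms(1-3) by (rule mass_function_dempster)
  have sub: "x \<subseteq> ?U" if "x \<in> focal_elements (\<Theta>\<^sub>1 \<union> \<Theta>\<^sub>2) ?m" for x
    using assms(1,2) that by (rule focal_elements_dempster_subset_consensus_set)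
  have "plausibility (\<Theta>\<^sub>1 \<union> \<Theta>\<^sub>2 \<union> \<Theta>\<^sub>3) (dempster (\<Theta>\<^sub>1 \<union> \<Theta>\<^sub>2) ?m \<Theta>\<^sub>3 m\<^sub>3) ?U = 1"
    if m3: "mass_function \<Theta>\<^sub>3 m\<^sub>3" and k: "conflict (\<Theta>\<^sub>1 \<union> \<Theta>\<^sub>2) ?m \<Theta>\<^sub>3 m\<^sub>3 < 1" for \<Theta>\<^sub>3 m\<^sub>3
  proof (rule plausibility_eq_1[OF mass_function_dempster[OF m m3 k]])
    fix x assume "x \<in> focal_elements (\<Theta>\<^sub>1 \<union> \<Theta>\<^sub>2 \<union> \<Theta>\<^sub>3) (dempster (\<Theta>\<^sub>1 \<union> \<Theta>\<^sub>2) ?m \<Theta>\<^sub>3 m\<^sub>3)"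
    \<comment> \<open>Only the factor \<open>A\<close> coming from the first combination is kept: it
      already lies in the consensus set, and intersecting with \<open>B\<close> can only shrink
      it.\<close>
    with m m3 obtain A B where "A \<in> focal_elements (\<Theta>\<^sub>1 \<union> \<Theta>\<^sub>2) ?m" "x = A \<inter> B"
      by (rule focal_elements_dempster)
    with sub show "x \<subseteq> ?U" by blast
  qed
  moreover have "plausibility (\<Theta>\<^sub>1 \<union> \<Theta>\<^sub>2) ?m ?U = 1"
    using m sub by (rule plausibility_eq_1)
  ultimately show ?thesis
    by (simp add: Let_def)
qed

end
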